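(* Assume that $(\mathbf w_d)_{d\in\{0,\dots,D\}}$ is a sequence of independent random vectors (white noise assumption), and that the Bellman value functions $V^{\mathrm e}_d$, $d\in\{0,\dots,D+1\}$, are nonincreasing: for all $d\in\{0,\dots,D+1\}$ and all $(x,x')\in\mathbb X_d\times\mathbb X_d$, $x\le x'$ implies $V^{\mathrm e}_d(x)\ge V^{\mathrm e}_d(x')$. Define the sequence $(\underline V^{\mathrm P}_d)_{d\in\{0,\dots,D+1\}}$ by $\underline V^{\mathrm P}_{D+1}=K$ and, for all $d\in\{0,\dots,D\}$ (backward) and all $x\in\mathbb X_d$, $$\underline V^{\mathrm P}_d(x)=\sup_{p_{d+1}\in\mathbb R^{n_{d+1}},\ p_{d+1}\le 0}\Big(L^{\mathrm P}_d(x,p_{d+1})\ \dotplus\ \big(-(\underline V^{\mathrm P}_{d+1})^{\star}(p_{d+1})\big)\Big),$$ where $\dotplus$ is the Moreau lower addition. Then these functions are lower bounds of the relaxed Bellman value functions: $$\underline V^{\mathrm P}_d\le V^{\mathrm i}_d\qquad\text{for all }d\in\{0,\dots,D+1\}.$$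
   Context: Setting. Let $D\ge 0$ and $M\ge 1$ be integers and $(\Omega,\mathcal F,\mathbb P)$ a probability space, with expectation $\mathbb E$. Bold letters denote random variables and $\sigma(\mathbf z)$ is the $\sigma$-field generated by $\mathbf z$. For $d\in\{0,\dots,D\}$ (slow time) and $m\in\{0,\dots,M\}$ (fast time), $\mathbf w_{d,m}:\Omega\to\mathbb W_{d,m}$ is a random variable (noise) with values in a measurable space, $\mathbf w_d=(\mathbf w_{d,0},\dots,\mathbf w_{d,M})$ takes values in $\mathbb W_d=\prod_{m=0}^M\mathbb W_{d,m}$, and $\mathbf w_{d,0:m}=(\mathbf w_{d,0},\dots,\mathbf w_{d,m})$. Controls are random variables $\mathbf u_d=(\mathbf u_{d,0},\dots,\mathbf u_{d,M})$, with $\mathbf u_{d,m}:\Omega\to\mathbb U_{d,m}$, $\mathbb U_{d,m}$ a measurable space, and $\mathbb U_d=\prod_{m=0}^M\mathbb U_{d,m}$. States are random variables $\mathbf x_d:\Omega\to\mathbb X_d=\mathbb R^{n_d}$, $d\in\{0,\dots,D+1\}$. The instantaneous costs $L_d:\mathbb X_d\times\mathbb U_d\times\mathbb W_d\to[0,+\infty]$, the dynamics $f_d:\mathbb X_d\times\mathbb U_d\times\mathbb W_d\to\mathbb X_{d+1}$ ($d\in\{0,\dots,D\}$) and the final cost $K:\mathbb X_{D+1}\to[0,+\infty]$ are measurable. Inequalities between vectors are componentwise, and equalities and inequalities between random variables hold $\mathbb P$-almost surely. $\langle\cdot,\cdot\rangle$ is the standard scalar product. Bellman value functions. $V^{\mathrm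 e}_{D+1}=V^{\mathrm i}_{D+1}=K$ and, for $d=D,\dots,0$ and $x\in\mathbb X_d$, $$V^{\mathrm e}_d(x)=\inf_{\mathbf x_{d+1},\mathbf u_d}\mathbb E\big[L_d(x,\mathbf u_d,\mathbf w_d)+V^{\mathrm e}_{d+1}(\mathbf x_{d+1})\big]$$ subject to $\mathbf x_{d+1}=f_d(x,\mathbf u_d,\mathbf w_d)$ and $\sigma(\mathbf u_{d,m})\subset\sigma(\mathbf w_{d,0:m})$ for all $m\in\{0,\dots,M\}$; $$V^{\mathrm i}_d(x)=\inf_{\mathbf x_{d+1},\mathbf u_d}\mathbb E\big[L_d(x,\mathbf u_d,\mathbf w_d)+V^{\mathrm i}_{d+1}(\mathbf x_{d+1})\big]$$ subject to $f_d(x,\mathbf u_d,\mathbf w_d)\ge\mathbf x_{d+1}$, $\sigma(\mathbf u_{d,m})\subset\sigma(\mathbf w_{d,0:m})$ for all $m\in\{0,\dots,M\}$, and $\sigma(\mathbf x_{d+1})\subset\sigma(\mathbf w_{d,0:M})$. Price intraday functions. For $d\in\{0,\dots,D\}$, $x\in\mathbb X_d$ and $p\in\mathbb R^{n_{d+1}}$, $$L^{\mathrm P}_d(x,p)=\inf_{\mathbf u_d}\ \mathbb E\big[L_d(x,\mathbf u_d,\mathbf w_d)+\langle p,f_d(x,\mathbf u_d,\mathbf w_d)\rangle\big]\in[-\infty,+\infty]$$ subject to $\sigma(\mathbf u_{d,m})\subset\sigma(\mathbf w_{d,0:m})$ for all $m\in\{0,\dots,M\}$. The expectations appearing here are understood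 to be well defined in $[-\infty,+\infty]$. Conventions. The Moreau lower addition $\dotplus$ extends the usual addition to $[-\infty,+\infty]$ by $(+\infty)\dotplus(-\infty)=(-\infty)\dotplus(+\infty)=-\infty$. For $g:\mathbb R^n\to[-\infty,+\infty]$, the Fenchel conjugate is $g^\star(p)=\sup_{x\in\mathbb R^n}\big(\langle p,x\rangle-g(x)\big)$, $p\in\mathbb R^n$. *)

theory Defs
  imports "HOL-Probability.Probability"
begin

text \<open>
  All noise spaces live on one type \<open>'w\<close> and all control spaces on one type \<open>'u\<close>; the spaces for
  different indices are arbitrary measurable spaces on these types (with arbitrary carriers).
  Elements of \<open>noise_space\<close> and \<open>control_space\<close> have type \<^typ>\<open>'a measure\<close>, but only
  \<^const>\<open>space\<close> and \<^const>\<open>sets\<close> are ever used.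

  Slow time ranges over \<open>{..last_slow S}\<close> (final state at \<open>Suc (last_slow S)\<close>), fast time over
  \<open>{..last_fast S}\<close>.
\<close>

record ('o, 'w, 'u) two_timescale_problem =
  last_slow :: nat
  last_fast :: nat
  base :: "'o measure"
  noise_space :: "nat \<Rightarrow> nat \<Rightarrow> 'w measure"
  control_space :: "nat \<Rightarrow> nat \<Rightarrow> 'u measure"
  state_dim :: "nat \<Rightarrow> nat"
  noise :: "nat \<Rightarrow> nat \<Rightarrow> 'o \<Rightarrow> 'w"
  cost :: "nat \<Rightarrow> (nat \<Rightarrow> real) \<times> (nat \<Rightarrow> 'u) \<times> (nat \<Rightarrow> 'w) \<Rightarrow> ennreal"
  dynamics :: "nat \<Rightarrow> (nat \<Rightarrow> real) \<times> (nat \<Rightarrow> 'u) \<times> (nat \<Rightarrow> 'w) \<Rightarrow> nat \<Rightarrow> real"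
  final_cost :: "(nat \<Rightarrow> real) \<Rightarrow> ennreal"

text \<open>Vectors of dimension \<open>n\<close> are the extensional functions on \<open>{..<n}\<close>.\<close>

definition euclid :: "nat \<Rightarrow> (nat \<Rightarrow> real) measure" where
  "euclid n = Pi\<^sub>M {..<n} (\<lambda>_. borel)"

definition vec_le :: "nat \<Rightarrow> (nat \<Rightarrow> real) \<Rightarrow> (nat \<Rightarrow> real) \<Rightarrow> bool" where
  "vec_le n x y \<longleftrightarrow> (\<forall>i<n. x i \<le> y i)"

definition scalar_prod :: "nat \<Rightarrow> (nat \<Rightarrow> real) \<Rightarrow> (nat \<Rightarrow> real) \<Rightarrow> real" where
  "scalar_prod n p x = (\<Sum>i<n. p i * x i)"

definition fenchel_conj :: "nat \<Rightarrow> ((nat \<Rightarrow> real) \<Rightarrow> ereal) \<Rightarrow> (nat \<Rightarrow> real) \<Rightarrow> ereal" where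
  "fenchel_conj n g p = (SUP x\<in>space (euclid n). ereal (scalar_prod n p x) - g x)"

text \<open>The sum of the library type \<^typ>\<open>ereal\<close> satisfies \<open>\<infinity> + (-\<infinity>) = \<infinity>\<close>, hence a separate
  definition of the Moreau lower addition.\<close>

definition lower_plus :: "ereal \<Rightarrow> ereal \<Rightarrow> ereal" where
  "lower_plus a b = (if a = -\<infinity> \<or> b = -\<infinity> then -\<infinity> else a + b)"

text \<open>Since \<^const>\<open>e2ennreal\<close> maps negative numbers to 0, the two integrals below are those of the
  positive and of the negative part of \<open>g\<close>.\<close>

definition ext_expectation_defined :: "'o measure \<Rightarrow> ('o \<Rightarrow> ereal) \<Rightarrow> bool" where
  "ext_expectation_defined P g \<longleftrightarrow>
     (\<integral>\<^sup>+\<omega>. e2ennreal (g \<omega>) \<partial>P) < \<infinity> \<or> (\<integral>\<^sup>+\<omega>. e2ennreal (- g \<omega>) \<partial>P) < \<infinity>"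

definition ext_expectation :: "'o measure \<Rightarrow> ('o \<Rightarrow> ereal) \<Rightarrow> ereal" where
  "ext_expectation P g =
     enn2ereal (\<integral>\<^sup>+\<omega>. e2ennreal (g \<omega>) \<partial>P) - enn2ereal (\<integral>\<^sup>+\<omega>. e2ennreal (- g \<omega>) \<partial>P)"

definition generated_field :: "'o measure \<Rightarrow> ('o \<Rightarrow> 'a) \<Rightarrow> 'a measure \<Rightarrow> 'o set set" where
  "generated_field P z N = sets (vimage_algebra (space P) z N)"

definition state_space :: "('o, 'w, 'u) two_timescale_problem \<Rightarrow> nat \<Rightarrow> (nat \<Rightarrow> real) measure" where
  "state_space S d = euclid (state_dim S d)"

definition controls_space :: "('o, 'w, 'u) two_timescale_problem \<Rightarrow> nat \<Rightarrow> (nat \<Rightarrow> 'u) measure" where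
  "controls_space S d = Pi\<^sub>M {..last_fast S} (control_space S d)"

definition noises_space ::
  "('o, 'w, 'u) two_timescale_problem \<Rightarrow> nat \<Rightarrow> nat \<Rightarrow> (nat \<Rightarrow> 'w) measure" where
  "noises_space S d m = Pi\<^sub>M {..m} (noise_space S d)"

definition noises :: "('o, 'w, 'u) two_timescale_problem \<Rightarrow> nat \<Rightarrow> nat \<Rightarrow> 'o \<Rightarrow> nat \<Rightarrow> 'w" where
  "noises S d m \<omega> = (\<lambda>i\<in>{..m}. noise S d i \<omega>)"

abbreviation slow_noise_space ::
  "('o, 'w, 'u) two_timescale_problem \<Rightarrow> nat \<Rightarrow> (nat \<Rightarrow> 'w) measure" where
  "slow_noise_space S d \<equiv> noises_space S d (last_fast S)"

abbreviation slow_noise :: "('o, 'w, 'u) two_timescale_problem \<Rightarrow> nat \<Rightarrow> 'o \<Rightarrow> nat \<Rightarrow> 'w" where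
  "slow_noise S d \<equiv> noises S d (last_fast S)"

locale two_timescale =
  fixes S :: "('o, 'w, 'u) two_timescale_problem"
  assumes prob_space_base: "prob_space (base S)"
    and last_fast_ge_1: "last_fast S \<ge> 1"
    and noise_measurable:
      "\<And>d m. d \<le> last_slow S \<Longrightarrow> m \<le> last_fast S \<Longrightarrow> noise S d m \<in> base S \<rightarrow>\<^sub>M noise_space S d m"
    and cost_measurable:
      "\<And>d. d \<le> last_slow S \<Longrightarrow>
        cost S d \<in> state_space S d \<Otimes>\<^sub>M controls_space S d \<Otimes>\<^sub>M slow_noise_space S d \<rightarrow>\<^sub>M borel"
    and dynamics_measurable:
      "\<And>d. d \<le> last_slow S \<Longrightarrow>
        dynamics S d \<in> state_space S d \<Otimes>\<^sub>M controls_space S d \<Otimes>\<^sub>M slow_noise_space S d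
          \<rightarrow>\<^sub>M state_space S (Suc d)"
    and final_cost_measurable: "final_cost S \<in> state_space S (Suc (last_slow S)) \<rightarrow>\<^sub>M borel"

definition admissible_controls ::
  "('o, 'w, 'u) two_timescale_problem \<Rightarrow> nat \<Rightarrow> ('o \<Rightarrow> nat \<Rightarrow> 'u) set" where
  "admissible_controls S d =
     {u \<in> base S \<rightarrow>\<^sub>M controls_space S d.
        \<forall>m\<le>last_fast S.
          generated_field (base S) (\<lambda>\<omega>. u \<omega> m) (control_space S d m)
            \<subseteq> generated_field (base S) (noises S d m) (noises_space S d m)}"

definition exact_decisions ::
  "('o, 'w, 'u) two_timescale_problem \<Rightarrow> nat \<Rightarrow> (nat \<Rightarrow> real)
    \<Rightarrow> (('o \<Rightarrow> nat \<Rightarrow> real) \<times> ('o \<Rightarrow> nat \<Rightarrow> 'u)) set" where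
  "exact_decisions S d x =
     {(y, u). y \<in> base S \<rightarrow>\<^sub>M state_space S (Suc d) \<and> u \<in> admissible_controls S d \<and>
        (AE \<omega> in base S. y \<omega> = dynamics S d (x, u \<omega>, slow_noise S d \<omega>))}"

definition relaxed_decisions ::
  "('o, 'w, 'u) two_timescale_problem \<Rightarrow> nat \<Rightarrow> (nat \<Rightarrow> real)
    \<Rightarrow> (('o \<Rightarrow> nat \<Rightarrow> real) \<times> ('o \<Rightarrow> nat \<Rightarrow> 'u)) set" where
  "relaxed_decisions S d x =
     {(y, u). y \<in> base S \<rightarrow>\<^sub>M state_space S (Suc d) \<and> u \<in> admissible_controls S d \<and>
        (AE \<omega> in base S.
           vec_le (state_dim S (Suc d)) (y \<omega>) (dynamics S d (x, u \<omega>, slow_noise S d \<omega>))) \<and>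
        generated_field (base S) y (state_space S (Suc d))
          \<subseteq> generated_field (base S) (slow_noise S d) (slow_noise_space S d)}"

text \<open>Value functions need not be measurable; \<^const>\<open>nn_integral\<close> is then the lower integral.\<close>

function exact_value ::
  "('o, 'w, 'u) two_timescale_problem \<Rightarrow> nat \<Rightarrow> (nat \<Rightarrow> real) \<Rightarrow> ennreal" where
  "exact_value S d =
     (if d \<le> last_slow S
      then \<lambda>x. INF (y, u)\<in>exact_decisions S d x.
             \<integral>\<^sup>+\<omega>. cost S d (x, u \<omega>, slow_noise S d \<omega>) + exact_value S (Suc d) (y \<omega>) \<partial>base S
      else final_cost S)"
  by auto
termination
  by (relation "Wellfounded.measure (\<lambda>(S, d). Suc (last_slow S) - d)") auto

function relaxed_value ::
  "('o, 'w, 'u) two_timescale_problem \<Rightarrow> nat \<Rightarrow> (nat \<Rightarrow> real) \<Rightarrow> ennreal" where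
  "relaxed_value S d =
     (if d \<le> last_slow S
      then \<lambda>x. INF (y, u)\<in>relaxed_decisions S d x.
             \<integral>\<^sup>+\<omega>. cost S d (x, u \<omega>, slow_noise S d \<omega>) + relaxed_value S (Suc d) (y \<omega>) \<partial>base S
      else final_cost S)"
  by auto
termination
  by (relation "Wellfounded.measure (\<lambda>(S, d). Suc (last_slow S) - d)") auto

definition priced_cost ::
  "('o, 'w, 'u) two_timescale_problem \<Rightarrow> nat \<Rightarrow> (nat \<Rightarrow> real) \<Rightarrow> (nat \<Rightarrow> real)
    \<Rightarrow> ('o \<Rightarrow> nat \<Rightarrow> 'u) \<Rightarrow> 'o \<Rightarrow> ereal" where
  "priced_cost S d x p u \<omega> =
     enn2ereal (cost S d (x, u \<omega>, slow_noise S d \<omega>))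
     + ereal (scalar_prod (state_dim S (Suc d)) p (dynamics S d (x, u \<omega>, slow_noise S d \<omega>)))"

definition price_intraday ::
  "('o, 'w, 'u) two_timescale_problem \<Rightarrow> nat \<Rightarrow> (nat \<Rightarrow> real) \<Rightarrow> (nat \<Rightarrow> real) \<Rightarrow> ereal" where
  "price_intraday S d x p =
     (INF u\<in>admissible_controls S d. ext_expectation (base S) (priced_cost S d x p u))"

function price_value ::
  "('o, 'w, 'u) two_timescale_problem \<Rightarrow> nat \<Rightarrow> (nat \<Rightarrow> real) \<Rightarrow> ereal" where
  "price_value S d =
     (if d \<le> last_slow S
      then \<lambda>x. SUP p\<in>{p \<in> space (state_space S (Suc d)). vec_le (state_dim S (Suc d)) p (\<lambda>_. 0)}.
             lower_plus (price_intraday S d x p)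
               (- fenchel_conj (state_dim S (Suc d)) (price_value S (Suc d)) p)
      else (\<lambda>x. enn2ereal (final_cost S x)))"
  by auto
termination
  by (relation "Wellfounded.measure (\<lambda>(S, d). Suc (last_slow S) - d)") auto

declare exact_value.simps [simp del] relaxed_value.simps [simp del] price_value.simps [simp del]

end

theory Submission
  imports Defs
begin

text \<open>
  Backward induction on \<open>d\<close>. For a price \<open>p \<le> 0\<close> and a relaxed decision \<open>(y, u)\<close>, the constraint
  \<open>y \<le> f\<^sub>d(x, u, w\<^sub>d)\<close> gives \<open>\<langle>p, f\<^sub>d\<rangle> \<le> \<langle>p, y\<rangle>\<close>, and the Fenchel inequality together with the
  induction hypothesis \<open>V \<le> W\<close> for the price value \<open>V\<close> and the relaxed value \<open>W\<close> at \<open>d + 1\<close> gives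
  \<open>- V\<^sup>\<star>(p) \<le> W(y) - \<langle>p, y\<rangle>\<close>. Adding the two and taking expectations yields the bound. Since \<open>W(y)\<close> need not be
  measurable, the expectation is taken of the measurable minorant \<open>(L\<^sub>d + \<langle>p, f\<^sub>d\<rangle> - V\<^sup>\<star>(p))\<^sup>+\<close>.
\<close>

lemma scalar_prod_antimono:
  assumes "vec_le n p (\<lambda>_. 0)" "vec_le n x y"
  shows "scalar_prod n p y \<le> scalar_prod n p x"
  using assms by (auto simp: scalar_prod_def vec_le_def intro!: sum_mono mult_left_mono_neg)

text \<open>Testing the supremum at \<open>x\<close> gives this. Since the scalar product is finite,
  the rearrangement also holds where \<open>g x\<close> or the conjugate is infinite.\<close>

lemma neg_fenchel_conj_le:
  assumes "x \<in> space (euclid n)"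
  shows "- fenchel_conj n g p \<le> g x - ereal (scalar_prod n p x)"
proof -
  have "ereal (scalar_prod n p x) - g x \<le> fenchel_conj n g p"
    unfolding fenchel_conj_def using assms by (rule SUP_upper)
  then show ?thesis
    by (cases "g x"; cases "fenchel_conj n g p") auto
qed

text \<open>A negative \<open>a\<close> is harmless because the right side is nonnegative. This
  carries a bound on an infimum in \<open>ennreal\<close> over to \<open>ereal\<close>.\<close>

lemma le_enn2ereal_if_e2ennreal_le:
  assumes "e2ennreal a \<le> b"
  shows "a \<le> enn2ereal b"
proof (cases "0 \<le> a")
  case True
  with assms show ?thesis by (simp add: less_eq_ennreal.rep_eq enn2ereal_e2ennreal)
next
  case False
  then show ?thesis
    using enn2ereal_nonneg[of b] by (meson linear order_trans)
qed

lemma e2ennreal_le_if_le_enn2ereal: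
  assumes "a \<le> enn2ereal b"
  shows "e2ennreal a \<le> b"
  using e2ennreal_mono[OF assms] by simp

text \<open>In terms of positive and negative parts, this says that a + c is at most its positive
  part, rearranged so that no difference of infinities occurs. An infinite \<open>a\<close> makes
  the right side infinite.\<close>

lemma e2ennreal_add_le:
  "e2ennreal a + ennreal c \<le> e2ennreal (a + ereal c) + e2ennreal (- a) + ennreal (- c)"
proof (cases a)
  case (real r)
  have "ennreal r + ennreal c \<le> ennreal (r + c) + ennreal (- r) + ennreal (- c)"
    by (cases "0 \<le> r"; cases "0 \<le> c"; cases "0 \<le> r + c")
      (auto simp: ennreal_neg simp flip: ennreal_plus intro!: ennreal_leI)
  with real show ?thesis
    by (simp flip: ennreal.abs_eq add: e2ennreal_ereal)
next
  case PInf
  then show ?thesis by (simp add: e2ennreal_infty)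
next
  case MInf
  then show ?thesis by (simp add: e2ennreal_infty e2ennreal_neg)
qed

text \<open>\<open>h\<close> may be nonmeasurable, so it enters only through monotonicity of
  \<open>nn_integral\<close>; additivity is applied to integrands built from \<open>g\<close> and
  \<open>c\<close>.\<close>

lemma (in prob_space) ext_expectation_add_const_le:
  assumes g [measurable]: "g \<in> borel_measurable M"
    and defined: "ext_expectation_defined M g"
    and le: "AE \<omega> in M. g \<omega> + ereal c \<le> enn2ereal (h \<omega>)"
  shows "ext_expectation M g + ereal c \<le> enn2ereal (\<integral>\<^sup>+\<omega>. h \<omega> \<partial>M)"
proof -
  define A where "A = (\<integral>\<^sup>+\<omega>. e2ennreal (g \<omega>) \<partial>M)"
  define B where "B = (\<integral>\<^sup>+\<omega>. e2ennreal (- g \<omega>) \<partial>M)"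
  define H where "H = (\<integral>\<^sup>+\<omega>. h \<omega> \<partial>M)"
  have "A + ennreal c = (\<integral>\<^sup>+\<omega>. e2ennreal (g \<omega>) + ennreal c \<partial>M)"
    by (simp add: A_def nn_integral_add emeasure_space_1)
  also have "\<dots> \<le> (\<integral>\<^sup>+\<omega>. e2ennreal (g \<omega> + ereal c) + e2ennreal (- g \<omega>) + ennreal (- c) \<partial>M)"
    by (intro nn_integral_mono e2ennreal_add_le)
  also have "\<dots> = (\<integral>\<^sup>+\<omega>. e2ennreal (g \<omega> + ereal c) \<partial>M) + B + ennreal (- c)"
    by (simp add: B_def nn_integral_add emeasure_space_1)
  also have "(\<integral>\<^sup>+\<omega>. e2ennreal (g \<omega> + ereal c) \<partial>M) \<le> H"
    unfolding H_def
  proof (rule nn_integral_mono_AE)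
    show "AE \<omega> in M. e2ennreal (g \<omega> + ereal c) \<le> h \<omega>"
      using le by eventually_elim (rule e2ennreal_le_if_le_enn2ereal)
  qed
  finally have key: "A + ennreal c \<le> H + B + ennreal (- c)"
    by (simp add: add_right_mono)
  have AB: "A < \<infinity> \<or> B < \<infinity>"
    using defined by (simp add: ext_expectation_defined_def A_def B_def)
  have "enn2ereal A - enn2ereal B + ereal c \<le> enn2ereal H"
  proof (cases B)
    \<comment> \<open>Here \<open>AB\<close> makes \<open>A\<close> finite, so the left side is
      -\<infinity>.\<close>
    case top
    with AB show ?thesis
      by (cases A) (auto simp: enn2ereal_ennreal)
  next
    case B: (real b)
    show ?thesis
    proof (cases H)
      case top
      then show ?thesis by simp
    next
      case H: (real h)
      \<comment> \<open>The right side of \<open>key\<close> is finite, hence so is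
        \<open>A\<close>, and the claim reduces to real numbers.\<close>
      with B key have "A \<noteq> top"
        by (auto simp: top_unique simp flip: ennreal_plus)
      then obtain a where A: "A = ennreal a" "0 \<le> a"
        by (cases A) auto
      have "a + c \<le> h + b"
        using key A B H
        by (cases "0 \<le> c") (auto simp: ennreal_neg ennreal_le_iff simp flip: ennreal_plus)
      then show ?thesis
        using A B H by (simp add: enn2ereal_ennreal)
    qed
  qed
  then show ?thesis
    by (simp add: ext_expectation_def A_def B_def H_def)
qed

context two_timescale
begin

interpretation prob_space "base S"
  by (rule prob_space_base)

lemma slow_noise_measurable:
  assumes "d \<le> last_slow S"
  shows "slow_noise S d \<in> base S \<rightarrow>\<^sub>M slow_noise_space S d"
  unfolding noises_def noises_space_def
  using noise_measurable[OF assms] by (intro measurable_restrict) auto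

lemma stage_argument_measurable:
  assumes d: "d \<le> last_slow S" and x: "x \<in> space (state_space S d)"
    and u: "u \<in> admissible_controls S d"
  shows "(\<lambda>\<omega>. (x, u \<omega>, slow_noise S d \<omega>))
    \<in> base S \<rightarrow>\<^sub>M state_space S d \<Otimes>\<^sub>M controls_space S d \<Otimes>\<^sub>M slow_noise_space S d"
  using u x slow_noise_measurable[OF d]
  by (intro measurable_Pair measurable_const) (auto simp: admissible_controls_def)

lemma priced_cost_measurable:
  assumes d: "d \<le> last_slow S" and x: "x \<in> space (state_space S d)"
    and u: "u \<in> admissible_controls S d"
  shows "priced_cost S d x p u \<in> borel_measurable (base S)"
proof -
  note arg = stage_argument_measurable[OF assms]
  have [measurable]: "(\<lambda>\<omega>. cost S d (x, u \<omega>, slow_noise S d \<omega>)) \<in> borel_measurable (base S)"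
    by (rule measurable_compose[OF arg cost_measurable[OF d]])
  have dyn: "(\<lambda>\<omega>. dynamics S d (x, u \<omega>, slow_noise S d \<omega>))
      \<in> base S \<rightarrow>\<^sub>M Pi\<^sub>M {..<state_dim S (Suc d)} (\<lambda>_. borel)"
    using measurable_compose[OF arg dynamics_measurable[OF d]]
    by (simp add: state_space_def euclid_def)
  have "(\<lambda>\<omega>. scalar_prod (state_dim S (Suc d)) p (dynamics S d (x, u \<omega>, slow_noise S d \<omega>)))
      \<in> borel_measurable (base S)"
    unfolding scalar_prod_def
    by (intro borel_measurable_sum borel_measurable_times measurable_const
        measurable_compose[OF dyn measurable_component_singleton]) auto
  then show ?thesis
    unfolding priced_cost_def[abs_def] by measurable
qed

text \<open>Fixing one price and one decision separates the duality bound from the recursion;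
  \<open>V\<close> and \<open>W\<close> stand for the two value functions of the next stage.\<close>

lemma price_term_le_relaxed_cost:
  assumes d: "d \<le> last_slow S" and x: "x \<in> space (state_space S d)"
    and p: "vec_le (state_dim S (Suc d)) p (\<lambda>_. 0)"
    and yu: "(y, u) \<in> relaxed_decisions S d x"
    and defined: "ext_expectation_defined (base S) (priced_cost S d x p u)"
    and V_le: "\<And>z. z \<in> space (state_space S (Suc d)) \<Longrightarrow> V z \<le> enn2ereal (W z)"
  shows "lower_plus (price_intraday S d x p) (- fenchel_conj (state_dim S (Suc d)) V p)
    \<le> enn2ereal (\<integral>\<^sup>+\<omega>. cost S d (x, u \<omega>, slow_noise S d \<omega>) + W (y \<omega>) \<partial>base S)"
proof -
  let ?n = "state_dim S (Suc d)"
  let ?C = "\<lambda>\<omega>. cost S d (x, u \<omega>, slow_noise S d \<omega>)"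
  let ?f = "\<lambda>\<omega>. dynamics S d (x, u \<omega>, slow_noise S d \<omega>)"
  let ?rhs = "enn2ereal (\<integral>\<^sup>+\<omega>. ?C \<omega> + W (y \<omega>) \<partial>base S)"
  from yu have y: "y \<in> base S \<rightarrow>\<^sub>M state_space S (Suc d)" and u: "u \<in> admissible_controls S d"
    and y_le: "AE \<omega> in base S. vec_le ?n (y \<omega>) (?f \<omega>)"
    by (auto simp: relaxed_decisions_def)
  have fenchel: "- fenchel_conj ?n V p \<le> enn2ereal (W (y \<omega>)) - ereal (scalar_prod ?n p (y \<omega>))"
    if "\<omega> \<in> space (base S)" for \<omega>
  proof -
    have z: "y \<omega> \<in> space (state_space S (Suc d))"
      using measurable_space[OF y that] .
    then have "- fenchel_conj ?n V p \<le> V (y \<omega>) - ereal (scalar_prod ?n p (y \<omega>))"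
      by (intro neg_fenchel_conj_le) (simp add: state_space_def)
    also have "\<dots> \<le> enn2ereal (W (y \<omega>)) - ereal (scalar_prod ?n p (y \<omega>))"
      by (intro ereal_minus_mono V_le z order_refl)
    finally show ?thesis .
  qed
  show ?thesis
  proof (cases "- fenchel_conj ?n V p")
    \<comment> \<open>A finite constant can be moved under the expectation for the given
      \<open>u\<close>, which in turn bounds the infimum \<open>price_intraday\<close> from
      above.\<close>
    case (real c)
    have "AE \<omega> in base S. priced_cost S d x p u \<omega> + ereal c \<le> enn2ereal (?C \<omega> + W (y \<omega>))"
      using y_le AE_space
    proof eventually_elim
      case (elim \<omega>)
      have "scalar_prod ?n p (?f \<omega>) \<le> scalar_prod ?n p (y \<omega>)"
        using scalar_prod_antimono[OF p elim(1)] .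
      moreover have "ereal c \<le> enn2ereal (W (y \<omega>)) - ereal (scalar_prod ?n p (y \<omega>))"
        using fenchel[OF elim(2)] real by simp
      ultimately show ?case
        by (cases "enn2ereal (W (y \<omega>))"; cases "enn2ereal (?C \<omega>)")
          (auto simp: priced_cost_def plus_ennreal.rep_eq)
    qed
    then have "ext_expectation (base S) (priced_cost S d x p u) + ereal c \<le> ?rhs"
      using priced_cost_measurable[OF d x u] defined by (intro ext_expectation_add_const_le)
    moreover have "price_intraday S d x p \<le> ext_expectation (base S) (priced_cost S d x p u)"
      unfolding price_intraday_def using u by (rule INF_lower)
    ultimately show ?thesis
      unfolding lower_plus_def real
      by (auto intro: order_trans[OF add_right_mono])
  next
    case PInf
    \<comment> \<open>The scalar product is finite, so only an infinite \<open>W\<close> satisfies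
      the Fenchel bound; total mass 1 then makes the right side infinite.\<close>
    have "W (y \<omega>) = \<infinity>" if "\<omega> \<in> space (base S)" for \<omega>
      using fenchel[OF that] PInf by (cases "W (y \<omega>)") (auto simp: enn2ereal_ennreal)
    then have "(\<integral>\<^sup>+\<omega>. ?C \<omega> + W (y \<omega>) \<partial>base S) = (\<integral>\<^sup>+\<omega>. \<infinity> \<partial>base S)"
      by (intro nn_integral_cong) simp
    then show ?thesis
      by (simp add: emeasure_space_1)
  next
    case MInf
    \<comment> \<open>The Moreau convention decides here: the term is -\<infinity> even if
      \<open>price_intraday\<close> is \<infinity>.\<close>
    then show ?thesis by (simp add: lower_plus_def)
  qed
qed

text \<open>Weak duality: the stage bound holds for every pair of price and decision, so it survives
  the infimum over decisions and then the supremum over prices.\<close>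

lemma price_value_le_relaxed_value:
  assumes defined: "\<And>d x p u. d \<le> last_slow S \<Longrightarrow> x \<in> space (state_space S d) \<Longrightarrow>
        p \<in> space (state_space S (Suc d)) \<Longrightarrow> u \<in> admissible_controls S d \<Longrightarrow>
        ext_expectation_defined (base S) (priced_cost S d x p u)"
    and "d \<le> Suc (last_slow S)" "x \<in> space (state_space S d)"
  shows "price_value S d x \<le> enn2ereal (relaxed_value S d x)"
  using assms(2,3)
\<comment> \<open>The induction descends from \<open>Suc (last_slow S)\<close>, where both values
  are the final cost.\<close>
proof (induction d arbitrary: x rule: inc_induct)
  case base
  then show ?case
    by (simp add: price_value.simps relaxed_value.simps)
next
  case (step d)
  then have d: "d \<le> last_slow S" by simp
  have "lower_plus (price_intraday S d x p)
        (- fenchel_conj (state_dim S (Suc d)) (price_value S (Suc d)) p)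
      \<le> enn2ereal (relaxed_value S d x)" (is "?l \<le> _")
    if p: "p \<in> space (state_space S (Suc d))" "vec_le (state_dim S (Suc d)) p (\<lambda>_. 0)" for p
  proof -
    \<comment> \<open>Truncation at 0 moves the bound to \<open>ennreal\<close>, where the infimum
      defining \<open>relaxed_value\<close> is taken.\<close>
    have "e2ennreal ?l \<le>
        (\<integral>\<^sup>+\<omega>. cost S d (x, u \<omega>, slow_noise S d \<omega>) + relaxed_value S (Suc d) (y \<omega>) \<partial>base S)"
      if yu: "(y, u) \<in> relaxed_decisions S d x" for y u
    proof -
      have "u \<in> admissible_controls S d"
        using yu by (simp add: relaxed_decisions_def)
      with d step.prems p yu show ?thesis
        by (intro e2ennreal_le_if_le_enn2ereal price_term_le_relaxed_cost defined step.IH)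
    qed
    then have "e2ennreal ?l \<le> relaxed_value S d x"
      using d by (subst relaxed_value.simps) (auto intro!: INF_greatest)
    then show ?thesis
      by (rule le_enn2ereal_if_e2ennreal_le)
  qed
  then show ?case
    using d by (subst price_value.simps) (auto intro!: SUP_least)
qed

end

theorem proposition9:
  fixes S :: "('o, 'w, 'u) two_timescale_problem"
  assumes "two_timescale S"
    and well_defined:
      "\<And>d x p u. d \<le> last_slow S \<Longrightarrow> x \<in> space (state_space S d) \<Longrightarrow>
        p \<in> space (state_space S (Suc d)) \<Longrightarrow> u \<in> admissible_controls S d \<Longrightarrow>
        ext_expectation_defined (base S) (priced_cost S d x p u)"
    and white_noise:
      "prob_space.indep_vars (base S) (slow_noise_space S) (slow_noise S) {..last_slow S}"
    and nonincreasing: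
      "\<And>d x x'. d \<le> Suc (last_slow S) \<Longrightarrow> x \<in> space (state_space S d) \<Longrightarrow>
        x' \<in> space (state_space S d) \<Longrightarrow> vec_le (state_dim S d) x x' \<Longrightarrow>
        exact_value S d x \<ge> exact_value S d x'"
  shows "\<forall>d\<le>Suc (last_slow S). \<forall>x\<in>space (state_space S d).
           price_value S d x \<le> enn2ereal (relaxed_value S d x)"
proof -
  interpret two_timescale S by fact
  show ?thesis
    using price_value_le_relaxed_value[OF well_defined] by blast
qed

end
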